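(* Let $X=\mathbb{R}^K$, $I=\{1,\dots,N\}$. For every $i\in I$ let $\Phi_i\in\mathcal{C}^1(X,\mathbb{R})$ be strongly convex with constant $\mu>0$ and let $\nabla\Phi_i$ be Lipschitz with constant $L>0$; let $\theta^i_*$ be the critical point of $\Phi_i$. Let $m:[0,\infty)\to(0,\infty)$ be strictly decreasing and differentiable with $\lim_{t\to\infty}m(t)=0$, $m(0)=:m_0\le1$, and $|m'(t)|\le\lambda m(t)$ for $t>0$, where $\lambda=\min\{\mu/4,1/4\}$. Let $(\tilde p_t,\tilde q_t)_{t\ge0}$ and $(\theta_t)_{t\ge0}$ solve, with the same index process $(i(t))_{t\ge 0}$, $$\mathrm{d}\tilde q_t=\tilde p_t\,\mathrm{d}t,\qquad m(t)\,\mathrm{d}\tilde p_t=-\nabla\Phi_{i(t)}(\tilde q_t)\,\mathrm{d}t-\tilde p_t\,\mathrm{d}t,\qquad \tilde p_0,\tilde q_0\in X,$$ $$\frac{\mathrm{d}\theta_t}{\mathrm{d}t}=-\nabla\Phi_{i(t)}(\theta_t),\qquad\theta_0\in X.$$ Let $(\tau_n)_{n\ge1}$ be the sequence of jump times of $(i(t))_{t\ge0}$. Assume that $$m_0\le\frac{(C^{(2)}_{L,\mu})^{-2}\mu^2}{4(2\gamma N+\mu)^2},$$ where $C^{(2)}_{L,\mu}=C^{(1)}_{L,\mu}+C^{(1)}_L$ (constants given in the context). Then $$\mathbb{E}\big[\|\tilde q_{\tau_n}-\theta_{\tau_n}\|\big]\to0\qquad(n\to\infty).$$ If, additionally, there exist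 $C,c>0$ such that $m(t)\le Ce^{-ct}$ for all $t\ge0$, then $$\|\tilde q_t-\theta_t\|\to0\qquad(t\to\infty)$$ almost surely and in expectation.
   Context: $\|\cdot\|$ is the Euclidean norm. $\Phi_i$ is strongly convex with constant $\mu$ if $(x-x')\cdot(\nabla\Phi_i(x)-\nabla\Phi_i(x'))\ge\mu\|x-x'\|^2$ for all $x,x'\in X$. The index process $(i(t))_{t\ge0}$ is the continuous-time Markov process on $I$ with transition rate matrix $\mathbf{\Gamma}_N-N\gamma\,\mathbf{I}_N$, where $\gamma>0$, $\mathbf{\Gamma}_N$ is the $N\times N$ matrix with all entries equal to $\gamma$, $\mathbf{I}_N$ is the identity matrix, and $i(0)$ is uniformly distributed on $I$. The constants are $C^{(1)}_L=1+8L^2+8L$, $C^{(2)}_L=8(1+8L^2+8L)^2$ and $C^{(1)}_{L,\mu}=2C^{(2)}_L\mu^{-1/2}(1+\mu^{-1/2}+\mu^{1/2})+\mu^{1/2}$. *)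

theory Defs
  imports "HOL-Probability.Probability"
begin

section \<open>Gradients and strong convexity\<close>

definition grad :: "('a::real_inner \<Rightarrow> real) \<Rightarrow> 'a \<Rightarrow> 'a" where
  "grad f x = (THE D. GDERIV f x :> D)"

lemma grad_eqI:
  assumes "GDERIV f x :> D"
  shows "grad f x = D"
  unfolding grad_def
proof (rule the_equality)
  fix D'
  assume "GDERIV f x :> D'"
  with assms have "(\<lambda>h. inner h D') = (\<lambda>h. inner h D)"
    unfolding gderiv_def using has_derivative_unique by blast
  then have "inner h D' = inner h D" for h
    by (rule fun_cong)
  then have "inner (D' - D) (D' - D) = 0"
    by (simp add: inner_diff_right)
  then show "D' = D"
    by simp
qed (rule assms)

definition C1_function :: "('a::real_inner \<Rightarrow> real) \<Rightarrow> bool" where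
  "C1_function f \<longleftrightarrow> (\<forall>x. \<exists>D. GDERIV f x :> D) \<and> continuous_on UNIV (grad f)"

definition strongly_convex :: "real \<Rightarrow> ('a::real_inner \<Rightarrow> real) \<Rightarrow> bool" where
  "strongly_convex \<mu> f \<longleftrightarrow>
     (\<forall>x x'. inner (x - x') (grad f x - grad f x') \<ge> \<mu> * (norm (x - x'))\<^sup>2)"

section \<open>Continuous-time Markov processes on a finite state space\<close>

text \<open>The library function \<open>exp\<close> is not available for the matrix product \<open>**\<close>.\<close>

definition matrix_exp :: "real ^ 'n ^ 'n \<Rightarrow> real ^ 'n ^ 'n" where
  "matrix_exp A = (\<Sum>k. (1 / fact k) *\<^sub>R (((**) A ^^ k) (mat 1)))"

text \<open>Right-continuous paths with left limits, for the discrete topology on the state space.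
  Such a path has finitely many jumps in every bounded interval.\<close>

definition cadlag_path :: "(real \<Rightarrow> 's) \<Rightarrow> bool" where
  "cadlag_path x \<longleftrightarrow>
     (\<forall>t\<ge>0. \<forall>\<^sub>F s in at_right t. x s = x t) \<and>
     (\<forall>t>0. \<exists>y. \<forall>\<^sub>F s in at_left t. x s = y)"

definition jumps :: "(real \<Rightarrow> 's) \<Rightarrow> real set" where
  "jumps x = {t. 0 < t \<and> \<not> (\<forall>\<^sub>F s in at_left t. x s = x t)}"

text \<open>\<open>jump_time x n\<close> is the \<open>n\<close>-th jump time for \<open>n \<ge> 1\<close>, with \<open>jump_time x 0 = 0\<close>. The infimum is
  attained for paths as above. If a path has fewer than \<open>n\<close> jumps, the last jump time is
  repeated; for the process below with at least two states this is a null event.\<close>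

primrec jump_time :: "(real \<Rightarrow> 's) \<Rightarrow> nat \<Rightarrow> real" where
  "jump_time x 0 = 0"
| "jump_time x (Suc n) =
     (if jumps x \<inter> {jump_time x n<..} = {} then jump_time x n
      else Inf (jumps x \<inter> {jump_time x n<..}))"

text \<open>The Markov property with respect to the natural filtration, with transition probabilities
  \<open>matrix_exp (h Q)\<close>; the history is conditioned on through its values at finitely many times.\<close>

definition markov_process ::
    "'w measure \<Rightarrow> real ^ 'n ^ 'n \<Rightarrow> (real \<Rightarrow> 'w \<Rightarrow> 'n) \<Rightarrow> bool" where
  "markov_process M Q X \<longleftrightarrow>
     (\<forall>t\<ge>0. X t \<in> measurable M (count_space UNIV)) \<and>
     (\<forall>\<omega>\<in>space M. cadlag_path (\<lambda>t. X t \<omega>)) \<and>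
     (\<forall>T s h a b x. finite T \<longrightarrow> T \<subseteq> {0..s} \<longrightarrow> 0 \<le> s \<longrightarrow> 0 \<le> h \<longrightarrow>
        \<P>(\<omega> in M. X s \<omega> = a \<and> (\<forall>u\<in>T. X u \<omega> = x u)) > 0 \<longrightarrow>
        \<P>(\<omega> in M. X (s + h) \<omega> = b \<bar> X s \<omega> = a \<and> (\<forall>u\<in>T. X u \<omega> = x u))
          = matrix_exp (h *\<^sub>R Q) $ a $ b)"

definition rate_matrix :: "real \<Rightarrow> real ^ 'n ^ 'n" where
  "rate_matrix \<gamma> = (\<chi> a b. \<gamma>) - (real CARD('n) * \<gamma>) *\<^sub>R mat 1"

definition index_process ::
    "'w measure \<Rightarrow> real \<Rightarrow> (real \<Rightarrow> 'w \<Rightarrow> 'n::finite) \<Rightarrow> bool" where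
  "index_process M \<gamma> X \<longleftrightarrow>
     markov_process M (rate_matrix \<gamma>) X \<and>
     (\<forall>a. \<P>(\<omega> in M. X 0 \<omega> = a) = 1 / real CARD('n))"

section \<open>Differential equations driven by a switching index\<close>

text \<open>The right-hand sides jump together with the index path \<open>x\<close>. A solution is a continuous
  function that satisfies the equation at every \<open>t \<ge> 0\<close> that is not a jump time (with the
  one-sided derivative at \<open>t = 0\<close>).\<close>

definition solves_gradient_flow ::
    "('n \<Rightarrow> 'a::real_inner \<Rightarrow> real) \<Rightarrow> (real \<Rightarrow> 'n) \<Rightarrow> (real \<Rightarrow> 'a) \<Rightarrow> bool" where
  "solves_gradient_flow \<Phi> x \<theta> \<longleftrightarrow>
     continuous_on {0..} \<theta> \<and>
     (\<forall>t\<in>{0..} - jumps x.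
        (\<theta> has_vector_derivative - grad (\<Phi> (x t)) (\<theta> t)) (at t within {0..}))"

definition solves_momentum_flow ::
    "('n \<Rightarrow> 'a::real_inner \<Rightarrow> real) \<Rightarrow> (real \<Rightarrow> real) \<Rightarrow> (real \<Rightarrow> 'n) \<Rightarrow>
     (real \<Rightarrow> 'a) \<Rightarrow> (real \<Rightarrow> 'a) \<Rightarrow> bool" where
  "solves_momentum_flow \<Phi> m x p q \<longleftrightarrow>
     continuous_on {0..} p \<and>
     (\<forall>t\<ge>0. (q has_vector_derivative p t) (at t within {0..})) \<and>
     (\<forall>t\<in>{0..} - jumps x. \<exists>p'.
        (p has_vector_derivative p') (at t within {0..}) \<and>
        m t *\<^sub>R p' = - grad (\<Phi> (x t)) (q t) - p t)"

section \<open>Constants\<close>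

definition C1_L :: "real \<Rightarrow> real" where
  "C1_L L = 1 + 8 * L\<^sup>2 + 8 * L"

definition C2_L :: "real \<Rightarrow> real" where
  "C2_L L = 8 * (1 + 8 * L\<^sup>2 + 8 * L)\<^sup>2"

definition C1_L_mu :: "real \<Rightarrow> real \<Rightarrow> real" where
  "C1_L_mu L \<mu> =
     2 * C2_L L * \<mu> powr (-1/2) * (1 + \<mu> powr (-1/2) + \<mu> powr (1/2)) + \<mu> powr (1/2)"

definition C2_L_mu :: "real \<Rightarrow> real \<Rightarrow> real" where
  "C2_L_mu L \<mu> = C1_L_mu L \<mu> + C1_L L"

end

theory Submission
  imports Defs "HOL-Real_Asymp.Real_Asymp"
begin

text \<open>The idea is to follow the two flows along a fixed path of the index and to bound their distance
  by a function of time that is the same for every path; randomness then enters only through the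
  times at which the distance is evaluated.

  Write \<open>w = m p\<close> for the momentum and \<open>e = q + w - \<theta>\<close>. Adding \<open>w\<close> to the position removes the
  fast variable: in \<open>(q + w)' = m' p - \<nabla>\<Phi>\<^sub>i(q)\<close> no factor \<open>1 / m\<close> is left, so \<open>q + w\<close> follows the
  gradient flow up to terms of size \<open>\<bar>w\<bar>\<close>. The friction damps \<open>w\<close> at rate \<open>1 / m\<close>,
  which is large, and \<open>w\<close> is driven by \<open>\<nabla>\<Phi>\<^sub>i(q)\<close>, which differs from \<open>\<nabla>\<Phi>\<^sub>i(\<theta>)\<close> by at most
  \<open>L (\<bar>e\<bar> + \<bar>w\<bar>)\<close>. For small mass this closes to
  \<open>V' \<le> - \<mu> V + 2 G\<^sup>2 m\<close> with \<open>V = \<bar>e\<bar>\<^sup>2 + \<bar>w\<bar>\<^sup>2\<close> (lemma \<open>gap_dissipation\<close>), where \<open>G\<close>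
  bounds \<open>\<nabla>\<Phi>\<^sub>i(\<theta>)\<close>. Such a \<open>G\<close> exists independently of the path, because strong convexity with a
  common constant confines \<open>\<theta>\<close> however the index switches (lemma \<open>gradient_flow_bounded\<close>). The
  bound on the initial mass in the theorem makes the differential inequality hold from time \<open>0\<close> on
  (lemma \<open>mass_smallness\<close>). As \<open>m\<close> tends to \<open>0\<close>, Gronwall's
  argument gives \<open>\<bar>q\<^sub>t - \<theta>\<^sub>t\<bar> \<le> F t\<close> with a bounded deterministic \<open>F\<close> that tends to \<open>0\<close> and
  is common to all index paths (lemma \<open>uniform_gap_bound\<close>).

  Convergence along paths and of the means at deterministic times can be read off from this bound.
  At the jump times it remains to see that \<open>\<tau>\<^sub>n\<close> tends to infinity almost surely; then dominated
  convergence applies to \<open>F (\<tau>\<^sub>n)\<close>. Jumps do not accumulate, so this means that jumps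
  never cease. With at least two states, the chain stays in its state for one unit of time with a
  probability below \<open>1\<close>, which is computed from the matrix exponential, and by the Markov property it
  almost surely does not stay there for ever (lemma \<open>AE_jump_after\<close>). For the expectations to make
  sense, \<open>\<tau>\<^sub>n\<close> must be measurable (lemma \<open>jump_time_measurable\<close>): this holds because a jump in an open
  interval is visible at the rational times in it.\<close>

section \<open>Jumps of right-continuous paths with left limits\<close>

text \<open>Near \<open>t\<close> the path is constant on either side, so only \<open>t\<close> itself can be a jump.\<close>

lemma jumps_not_islimpt:
  assumes "cadlag_path x" and "t \<ge> 0"
  shows "\<not> t islimpt jumps x"
proof -
  have nojump: "\<forall>\<^sub>F s in at_left u. x s = x u" if "a < u" "u < b" "\<And>s. a < s \<Longrightarrow> s < b \<Longrightarrow> x s = y" for a b u y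
  proof -
    have "\<forall>\<^sub>F s in at_left u. s \<in> {a<..<u}"
      by (rule eventually_at_left_real) (rule that)
    then show ?thesis
      by eventually_elim (use that in auto)
  qed
  obtain b where b: "b > t" "\<And>s. t < s \<Longrightarrow> s < b \<Longrightarrow> x s = x t"
    using assms unfolding cadlag_path_def eventually_at_right_field by blast
  have "\<exists>a<t. \<forall>u. a < u \<longrightarrow> u < t \<longrightarrow> u \<notin> jumps x"
  proof (cases "t = 0")
    case True
    then show ?thesis by (intro exI[of _ "-1"]) (auto simp: jumps_def)
  next
    case False
    then obtain a y where a: "a < t" "\<And>s. a < s \<Longrightarrow> s < t \<Longrightarrow> x s = y"
      using assms unfolding cadlag_path_def eventually_at_left_field by (metis less_eq_real_def)
    have "u \<notin> jumps x" if "a < u" "u < t" for u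
      using nojump[of a u t y] a(2) that by (auto simp: jumps_def)
    with a show ?thesis by blast
  qed
  then obtain a where a: "a < t" "\<And>u. a < u \<Longrightarrow> u < t \<Longrightarrow> u \<notin> jumps x" by blast
  have right: "u \<notin> jumps x" if "t < u" "u < b" for u
    using nojump[of t u b "x t"] b(2) that by (auto simp: jumps_def)
  show ?thesis
    unfolding islimpt_def
  proof
    assume *: "\<forall>T. t \<in> T \<longrightarrow> open T \<longrightarrow> (\<exists>y\<in>jumps x. y \<in> T \<and> y \<noteq> t)"
    from *[rule_format, of "{a<..<b}"] a b(1) obtain y where "y \<in> jumps x" "a < y" "y < b" "y \<noteq> t"
      by auto
    then show False using a(2)[of y] right[of y] by linarith
  qed
qed

lemma finite_jumps_Int_atMost:
  assumes "cadlag_path x"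
  shows "finite (jumps x \<inter> {..T})"
proof -
  have "finite ({0..T} \<inter> jumps x)"
    by (rule finite_not_islimpt_in_compact) (auto simp: jumps_not_islimpt[OF assms])
  moreover have "jumps x \<inter> {..T} \<subseteq> {0..T} \<inter> jumps x"
    by (auto simp: jumps_def)
  ultimately show ?thesis by (rule rev_finite_subset)
qed

lemma constant_between_jumps:
  assumes x: "cadlag_path x" and "0 \<le> a" and no: "jumps x \<inter> {a<..<b} = {}"
    and "s \<in> {a<..<b}" "t \<in> {a<..<b}"
  shows "x s = x t"
proof -
  have loc: "\<forall>\<^sub>F r in at u. x r = x u" if u: "u \<in> {a<..<b}" for u
  proof -
    have "u \<notin> jumps x" "u > 0" using no u \<open>0 \<le> a\<close> by auto
    then have "\<forall>\<^sub>F r in at_left u. x r = x u" by (simp add: jumps_def)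
    moreover have "\<forall>\<^sub>F r in at_right u. x r = x u"
      using x \<open>u > 0\<close> by (simp add: cadlag_path_def)
    ultimately show ?thesis by (simp add: eventually_at_split)
  qed
  have "x constant_on {a<..<b}"
  proof (rule locally_constant_imp_constant)
    show "connected {a<..<b}" by simp
  next
    fix u assume u: "u \<in> {a<..<b}"
    have "\<forall>\<^sub>F r in nhds u. x r = x u"
      using loc[OF u] by (simp add: eventually_nhds_conv_at)
    then obtain T where T: "open T" "u \<in> T" and const: "\<forall>r\<in>T. x r = x u"
      unfolding eventually_nhds by blast
    moreover have "openin (top_of_set {a<..<b}) ({a<..<b} \<inter> T)" "u \<in> {a<..<b} \<inter> T"
      using T u by auto
    ultimately show "\<exists>T. openin (top_of_set {a<..<b}) T \<and> u \<in> T \<and> (\<forall>r\<in>T. x r = x u)"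
      by blast
  qed
  then show ?thesis using assms(4,5) unfolding constant_on_def by metis
qed

text \<open>This form of "there is a jump in \<open>(a, b)\<close>" involves the path at countably many times only,
  which is what makes jump times measurable.\<close>

lemma jump_between_iff_rat:
  assumes x: "cadlag_path x" and "0 \<le> a"
  shows "jumps x \<inter> {a<..<b} \<noteq> {} \<longleftrightarrow>
    (\<exists>r\<in>\<rat>. \<exists>s\<in>\<rat>. a < r \<and> r < b \<and> a < s \<and> s < b \<and> x r \<noteq> x s)"
proof
  assume "\<exists>r\<in>\<rat>. \<exists>s\<in>\<rat>. a < r \<and> r < b \<and> a < s \<and> s < b \<and> x r \<noteq> x s"
  then obtain r s where "r \<in> {a<..<b}" "s \<in> {a<..<b}" "x r \<noteq> x s" by auto
  then show "jumps x \<inter> {a<..<b} \<noteq> {}"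
    using constant_between_jumps[OF x \<open>0 \<le> a\<close>, of b r s] by blast
next
  assume jump: "jumps x \<inter> {a<..<b} \<noteq> {}"
  show "\<exists>r\<in>\<rat>. \<exists>s\<in>\<rat>. a < r \<and> r < b \<and> a < s \<and> s < b \<and> x r \<noteq> x s"
  proof (rule ccontr)
    assume no: "\<not> ?thesis"
    from jump obtain t where t: "t \<in> jumps x" "a < t" "t < b" by auto
    have rat: "\<exists>r\<in>\<rat>. a < r \<and> r < b \<and> x r = x s" if s: "a < s" "s < b" for s
    proof -
      obtain d where d: "d > s" "\<And>r. s < r \<Longrightarrow> r < d \<Longrightarrow> x r = x s"
      proof -
        have "\<forall>\<^sub>F r in at_right s. x r = x s"
          using x s \<open>0 \<le> a\<close> unfolding cadlag_path_def by (meson less_imp_le order_le_less_trans)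
        then show ?thesis
          using that unfolding eventually_at_right_field by blast
      qed
      obtain r where "r \<in> \<rat>" "s < r" "r < min b d"
        using Rats_dense_in_real[of s "min b d"] s d(1) by auto
      with d(2)[of r] s show ?thesis by (intro bexI[of _ r]) auto
    qed
    have eq: "x s = x t" if s: "a < s" "s < b" for s
    proof -
      obtain r where r: "r \<in> \<rat>" "a < r" "r < b" "x r = x s" using rat[OF s] by blast
      obtain r' where r': "r' \<in> \<rat>" "a < r'" "r' < b" "x r' = x t" using rat[OF t(2,3)] by blast
      have "x r = x r'" using no r(1-3) r'(1-3) by blast
      then show ?thesis using r(4) r'(4) by simp
    qed
    have "\<forall>\<^sub>F s in at_left t. s \<in> {a<..<t}"
      by (rule eventually_at_left_real) (rule t)
    then have "\<forall>\<^sub>F s in at_left t. x s = x t"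
    proof eventually_elim
      case (elim s)
      then show ?case using t by (intro eq) auto
    qed
    with t show False by (simp add: jumps_def)
  qed
qed

lemma jump_time_nonneg: "jump_time x n \<ge> 0"
proof (induction n)
  case (Suc n)
  then show ?case
    by (auto intro!: cInf_greatest)
qed simp

lemma jump_times_tendsto_infinity:
  assumes x: "cadlag_path x" and inf: "\<And>T. jumps x \<inter> {T<..} \<noteq> {}"
  shows "filterlim (jump_time x) at_top sequentially"
proof -
  have next_jump: "jump_time x (Suc n) \<in> jumps x \<inter> {jump_time x n<..}" for n
  proof -
    let ?S = "jumps x \<inter> {jump_time x n<..}"
    obtain s where s: "s \<in> ?S" using inf by blast
    let ?F = "?S \<inter> {..s}"
    have fin: "finite ?F"
      by (rule finite_subset[OF _ finite_jumps_Int_atMost[OF x, of s]]) auto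
    \<comment> \<open>Only finitely many jumps precede \<open>s\<close>, so the infimum is attained.\<close>
    have "Inf ?S = Min ?F"
    proof (rule cInf_eq_minimum)
      have "Min ?F \<in> ?F" using fin s by (intro Min_in) auto
      then show "Min ?F \<in> ?S" by blast
      show "Min ?F \<le> y" if "y \<in> ?S" for y
      proof (cases "y \<le> s")
        case True
        then show ?thesis using fin that by (intro Min_le) auto
      next
        case False
        have "Min ?F \<le> s" using fin s by (intro Min_le) auto
        then show ?thesis using False by simp
      qed
    qed
    moreover have "Min ?F \<in> ?F" using fin s by (intro Min_in) auto
    ultimately show ?thesis using inf[of "jump_time x n"] by simp
  qed
  have mono: "strict_mono (jump_time x)"
    unfolding strict_mono_Suc_iff using next_jump by blast
  have unbounded: "\<exists>n. jump_time x n > T" for T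
  proof (rule ccontr)
    assume "\<not> ?thesis"
    then have "range (\<lambda>n. jump_time x (Suc n)) \<subseteq> jumps x \<inter> {..T}"
      using next_jump by (auto simp: not_less simp del: jump_time.simps)
    then have "finite (range (\<lambda>n. jump_time x (Suc n)))"
      using finite_jumps_Int_atMost[OF x] finite_subset by blast
    moreover have "inj (\<lambda>n. jump_time x (Suc n))"
      using strict_mono_imp_inj_on[OF mono] by (auto simp: inj_def simp del: jump_time.simps)
    ultimately show False using finite_imageD infinite_UNIV_nat by blast
  qed
  show ?thesis
    unfolding filterlim_at_top
  proof
    fix T
    obtain n where n: "jump_time x n > T" using unbounded by blast
    have "jump_time x k \<ge> T" if "k \<ge> n" for k
      using n strict_mono_less_eq[OF mono, of n k] that by linarith
    then show "\<forall>\<^sub>F k in sequentially. T \<le> jump_time x k"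
      unfolding eventually_sequentially by blast
  qed
qed


section \<open>Comparison of the two flows along one index path\<close>

text \<open>This is the Gronwall argument: \<open>exp (k * u) * (f u - c / k)\<close> has nonpositive derivative
  wherever \<open>f\<close> is differentiable. A finite exceptional set is allowed because the right-hand sides
  of the two flows are discontinuous at the jumps of the index.\<close>

lemma exponential_comparison:
  fixes f f' :: "real \<Rightarrow> real"
  assumes "s \<le> t" and k: "k > 0" and c: "c \<ge> 0" and S: "finite S"
    and cont: "continuous_on {s..t} f"
    and der: "\<And>u. u \<in> {s<..<t} - S \<Longrightarrow> (f has_real_derivative f' u) (at u)"
    and le: "\<And>u. u \<in> {s<..<t} - S \<Longrightarrow> f' u \<le> - k * f u + c"
  shows "f t \<le> exp (- k * (t - s)) * f s + c / k"
proof -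
  define G where "G = (\<lambda>u. exp (k * u) * (f u - c / k))"
  define D where "D = (\<lambda>u. if u \<in> {s<..<t} - S then exp (k * u) * (f' u + k * f u - c) else 0)"
  have "continuous_on {s..t} G"
    unfolding G_def by (intro continuous_intros cont)
  moreover have "(G has_vector_derivative D u) (at u)" if "u \<in> {s<..<t} - S" for u
  proof -
    have "(G has_real_derivative D u) (at u)"
      using that k unfolding G_def D_def
      by (auto intro!: derivative_eq_intros der simp: field_simps)
    then show ?thesis
      by (simp add: has_real_derivative_iff_has_vector_derivative)
  qed
  ultimately have "(D has_integral G t - G s) {s..t}"
    using S \<open>s \<le> t\<close> by (intro fundamental_theorem_of_calculus_interior_strong[where S = "S"]) auto
  moreover have "D u \<le> 0" for u
    using le[of u] by (auto simp: D_def intro!: mult_nonneg_nonpos)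
  ultimately have "G t - G s \<le> 0"
    using has_integral_le[OF _ has_integral_0, of D "G t - G s" "{s..t}"] by blast
  then have "exp (k * t) * (f t - c / k) \<le> exp (k * s) * (f s - c / k)"
    by (simp add: G_def)
  then have "exp (- (k * t)) * (exp (k * t) * (f t - c / k)) \<le> exp (- (k * t)) * (exp (k * s) * (f s - c / k))"
    by (rule mult_left_mono) simp
  moreover have "exp (- (k * t)) * (exp (k * t) * (f t - c / k)) = f t - c / k"
    by (simp add: exp_minus)
  moreover have "exp (- (k * t)) * exp (k * s) = exp (- k * (t - s))"
    by (simp add: exp_add[symmetric] right_diff_distrib)
  ultimately have "f t - c / k \<le> exp (- k * (t - s)) * (f s - c / k)"
    by (metis mult.assoc)
  also have "\<dots> \<le> exp (- k * (t - s)) * f s"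
    using k c by (intro mult_left_mono) auto
  finally show ?thesis by simp
qed

lemma at_within_nonneg: "u > 0 \<Longrightarrow> at u within {0..} = at (u::real)"
  by (rule at_within_open_subset[of _ "{0<..}"]) auto

lemma gradient_flow_derivative:
  assumes "solves_gradient_flow \<Phi> x \<theta>" "u > 0" "u \<notin> jumps x"
  shows "(\<theta> has_vector_derivative - grad (\<Phi> (x u)) (\<theta> u)) (at u)"
proof -
  have "u \<in> {0..} - jumps x" using assms by simp
  with assms(1) have "(\<theta> has_vector_derivative - grad (\<Phi> (x u)) (\<theta> u)) (at u within {0..})"
    unfolding solves_gradient_flow_def by blast
  then show ?thesis using at_within_nonneg[OF assms(2)] by simp
qed

lemma momentum_flow_position_continuous:
  assumes "solves_momentum_flow \<Phi> m x p q"
  shows "continuous_on {0..} q"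
  using assms by (intro differentiable_imp_continuous_on)
    (auto simp: solves_momentum_flow_def differentiable_on_def intro: differentiableI_vector)

text \<open>This is the derivative of \<open>\<bar>e\<bar>\<^sup>2 + \<bar>w\<bar>\<^sup>2\<close> along the flows at one point of time, with
  \<open>gq\<close>, \<open>gz\<close>, \<open>g\<theta>\<close> standing for the current gradient at \<open>q\<close>, \<open>q + w\<close>, \<open>\<theta>\<close>. Convexity gives
  \<open>- \<mu> \<bar>e\<bar>\<^sup>2\<close> and friction gives \<open>- \<bar>w\<bar>\<^sup>2 / m\<close>. Young's inequality lets half of the former
  and a quarter of the latter absorb the mixed terms and the forcing \<open>\<bar>w\<bar> G\<close>; the smallness of \<open>m\<close>
  says that the remaining three quarters of the friction dominate every \<open>\<bar>w\<bar>\<^sup>2\<close> that was produced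
  and still leave decay at the rate \<open>\<mu>\<close>.\<close>

lemma gap_dissipation:
  fixes q \<theta> p gq gz g\<theta> :: "'a::real_inner"
  assumes \<mu>: "\<mu> > 0" and L: "L \<ge> 0" and m: "m > 0" and m': "\<bar>m'\<bar> \<le> l * m"
    and e: "e = q + m *\<^sub>R p - \<theta>" and w: "w = m *\<^sub>R p"
    and convex: "e \<bullet> (gz - g\<theta>) \<ge> \<mu> * (norm e)\<^sup>2"
    and lip: "norm (gz - gq) \<le> L * norm w" "norm (gq - g\<theta>) \<le> L * norm (q - \<theta>)"
    and G: "norm g\<theta> \<le> G"
    and small: "m * (l + L + (2 * L + l)\<^sup>2 / (2 * \<mu>) + \<mu> / 2) \<le> 3 / 4"
  shows "2 * (e \<bullet> (m' *\<^sub>R p - gq + g\<theta>) + w \<bullet> (m' *\<^sub>R p - p - gq))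
    \<le> - \<mu> * ((norm e)\<^sup>2 + (norm w)\<^sup>2) + 2 * G\<^sup>2 * m"
proof -
  define a b where "a = norm e" and "b = norm w"
  have ab: "a \<ge> 0" "b \<ge> 0" by (auto simp: a_def b_def)
  have "norm (m' *\<^sub>R p) \<le> l * m * norm p"
    using m' by (simp add: mult_right_mono)
  then have mp: "norm (m' *\<^sub>R p) \<le> l * b"
    using m by (simp add: b_def w mult.assoc)
  have inner_le: "x \<bullet> y \<le> norm x * c" if "norm y \<le> c" for x y :: 'a and c
    using norm_cauchy_schwarz[of x y] mult_left_mono[OF that, of "norm x"] by simp
  have "norm (q - \<theta>) \<le> a + b"
    using norm_triangle_ineq4[of e w] by (simp add: e w a_def b_def)
  then have "norm (g\<theta> - gq) \<le> L * (a + b)"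
    using lip(2) L by (metis norm_minus_commute mult_left_mono order_trans)
  then have 1: "w \<bullet> (g\<theta> - gq) \<le> b * (L * (a + b))"
    unfolding b_def by (rule inner_le)
  have 2: "w \<bullet> (- g\<theta>) \<le> b * G"
    unfolding b_def by (rule inner_le) (use G in simp)
  have 3: "e \<bullet> (m' *\<^sub>R p) \<le> a * (l * b)" "w \<bullet> (m' *\<^sub>R p) \<le> b * (l * b)"
    using inner_le[OF mp] by (auto simp: a_def b_def)
  have 4: "e \<bullet> (gz - gq) \<le> a * (L * b)"
    unfolding a_def b_def by (rule inner_le) (rule lip)
  have 5: "w \<bullet> p = b\<^sup>2 / m"
    using m by (simp add: b_def w dot_square_norm power_mult_distrib power2_eq_square)
  have "e \<bullet> (m' *\<^sub>R p - gq + g\<theta>) + w \<bullet> (m' *\<^sub>R p - p - gq) =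
      e \<bullet> (m' *\<^sub>R p) - e \<bullet> (gz - g\<theta>) + e \<bullet> (gz - gq)
      + w \<bullet> (m' *\<^sub>R p) - w \<bullet> p + w \<bullet> (g\<theta> - gq) + w \<bullet> (- g\<theta>)"
    by (simp add: inner_diff_right inner_add_right)
  also have "\<dots> \<le> - \<mu> * a\<^sup>2 + (2 * L + l) * a * b + (l + L) * b\<^sup>2 - b\<^sup>2 / m + b * G"
    using 1 2 3 4 5 convex by (simp add: a_def[symmetric] algebra_simps power2_eq_square)
  finally have main: "e \<bullet> (m' *\<^sub>R p - gq + g\<theta>) + w \<bullet> (m' *\<^sub>R p - p - gq)
      \<le> - \<mu> * a\<^sup>2 + (2 * L + l) * a * b + (l + L) * b\<^sup>2 - b\<^sup>2 / m + b * G" .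
  have "0 \<le> (\<mu> * a - (2 * L + l) * b)\<^sup>2 / (2 * \<mu>)"
    using \<mu> by simp
  also have "\<dots> = \<mu> / 2 * a\<^sup>2 - (2 * L + l) * a * b + (2 * L + l)\<^sup>2 / (2 * \<mu>) * b\<^sup>2"
    using \<mu> by (simp add: field_simps power2_eq_square)
  finally have young1: "(2 * L + l) * a * b \<le> \<mu> / 2 * a\<^sup>2 + (2 * L + l)\<^sup>2 / (2 * \<mu>) * b\<^sup>2"
    by simp
  have "0 \<le> (2 * m * G - b)\<^sup>2 / (4 * m)"
    using m by simp
  also have "\<dots> = m * G\<^sup>2 + b\<^sup>2 / (4 * m) - b * G"
    using m by (simp add: field_simps power2_eq_square)
  finally have young2: "b * G \<le> m * G\<^sup>2 + b\<^sup>2 / (4 * m)"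
    by simp
  have "(l + L + (2 * L + l)\<^sup>2 / (2 * \<mu>) + \<mu> / 2) \<le> 3 / 4 / m"
    using small m by (subst pos_le_divide_eq) (auto simp: mult.commute)
  then have "(l + L + (2 * L + l)\<^sup>2 / (2 * \<mu>) + \<mu> / 2) * b\<^sup>2 \<le> 3 / 4 / m * b\<^sup>2"
    by (rule mult_right_mono) simp
  then have "(l + L) * b\<^sup>2 + (2 * L + l)\<^sup>2 / (2 * \<mu>) * b\<^sup>2 + \<mu> / 2 * b\<^sup>2 \<le> b\<^sup>2 / m - b\<^sup>2 / (4 * m)"
    using m by (simp add: field_simps)
  with main young1 young2
  have "e \<bullet> (m' *\<^sub>R p - gq + g\<theta>) + w \<bullet> (m' *\<^sub>R p - p - gq)
      \<le> - (\<mu> / 2) * (a\<^sup>2 + b\<^sup>2) + m * G\<^sup>2"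
    by (simp add: distrib_left)
  then show ?thesis
    unfolding a_def b_def by (simp add: mult.commute)
qed

locale switched_potentials =
  fixes \<Phi> :: "'n::finite \<Rightarrow> 'a::real_inner \<Rightarrow> real" and \<mu> L :: real
  assumes \<mu>: "\<mu> > 0" and strongly_convex: "\<And>a. strongly_convex \<mu> (\<Phi> a)"
    and lipschitz: "\<And>a. L-lipschitz_on UNIV (grad (\<Phi> a))"
begin

text \<open>The origin serves as a common reference point for all potentials: convexity pulls \<open>\<theta>\<close> towards it
  at rate \<open>\<mu>\<close>, up to the error \<open>A\<close> from the origin not being a critical point.\<close>

lemma gradient_flow_bounded:
  assumes x: "cadlag_path x" and flow: "solves_gradient_flow \<Phi> x \<theta>"
    and A: "\<And>a. norm (grad (\<Phi> a) 0) \<le> A" and "t \<ge> 0"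
  shows "(norm (\<theta> t))\<^sup>2 \<le> (norm (\<theta> 0))\<^sup>2 + (A / \<mu>)\<^sup>2"
proof -
  define f where "f = (\<lambda>u. \<theta> u \<bullet> \<theta> u)"
  define f' where "f' = (\<lambda>u. 2 * (\<theta> u \<bullet> - grad (\<Phi> (x u)) (\<theta> u)))"
  have cont: "continuous_on {0..} \<theta>"
    using flow by (simp add: solves_gradient_flow_def)
  note der = gradient_flow_derivative[OF flow]
  have "f t \<le> exp (- \<mu> * (t - 0)) * f 0 + A\<^sup>2 / \<mu> / \<mu>"
  proof (rule exponential_comparison[where S = "jumps x \<inter> {..t}" and f' = f'])
    show "continuous_on {0..t} f"
      unfolding f_def using cont by (intro continuous_intros continuous_on_subset[OF cont]) auto
    fix u assume u: "u \<in> {0<..<t} - jumps x \<inter> {..t}"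
    have "(\<theta> has_vector_derivative - grad (\<Phi> (x u)) (\<theta> u)) (at u)"
      by (rule der) (use u in auto)
    from bounded_bilinear.has_vector_derivative[OF bounded_bilinear_inner this this]
    have "(f has_vector_derivative f' u) (at u)"
      by (simp add: f_def f'_def inner_commute)
    then show "(f has_real_derivative f' u) (at u)"
      by (simp add: has_real_derivative_iff_has_vector_derivative)
    let ?g = "grad (\<Phi> (x u))" and ?r = "norm (\<theta> u)"
    have "\<mu> * ?r\<^sup>2 \<le> \<theta> u \<bullet> (?g (\<theta> u) - ?g 0)"
      using strongly_convex[of "x u", unfolded strongly_convex_def, rule_format, of "\<theta> u" 0] by simp
    moreover have "\<theta> u \<bullet> (- ?g 0) \<le> ?r * A"
      using norm_cauchy_schwarz[of "\<theta> u" "- ?g 0"] mult_left_mono[OF A, of ?r "x u"] by simp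
    ultimately have "f' u \<le> 2 * (?r * A) - 2 * (\<mu> * ?r\<^sup>2)"
      by (simp add: f'_def inner_diff_right)
    also have "0 \<le> (\<mu> * ?r - A)\<^sup>2 / \<mu>" using \<mu> by simp
    then have "2 * (?r * A) - 2 * (\<mu> * ?r\<^sup>2) \<le> - \<mu> * ?r\<^sup>2 + A\<^sup>2 / \<mu>"
      using \<mu> by (simp add: field_simps power2_eq_square)
    finally show "f' u \<le> - \<mu> * f u + A\<^sup>2 / \<mu>"
      by (simp add: f_def power2_norm_eq_inner)
  qed (use \<mu> \<open>t \<ge> 0\<close> in \<open>auto simp: finite_jumps_Int_atMost[OF x]\<close>)
  also have "exp (- \<mu> * (t - 0)) * f 0 \<le> 1 * f 0"
    using \<mu> \<open>t \<ge> 0\<close> by (intro mult_right_mono) (auto simp: f_def)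
  finally show ?thesis
    by (simp add: f_def power2_norm_eq_inner power_divide power2_eq_square[of \<mu>])
qed

end

locale vanishing_mass = switched_potentials \<Phi> \<mu> L
  for \<Phi> :: "'n::finite \<Rightarrow> 'a::real_inner \<Rightarrow> real" and \<mu> L :: real +
  fixes m :: "real \<Rightarrow> real" and l :: real
  assumes mass_pos: "\<And>t. t \<ge> 0 \<Longrightarrow> m t > 0" and mass_antimono: "antimono_on {0..} m"
    and mass_differentiable: "m differentiable_on {0..}"
    and mass_tendsto: "(m \<longlongrightarrow> 0) at_top"
    and mass_deriv: "\<And>t. t > 0 \<Longrightarrow> \<bar>deriv m t\<bar> \<le> l * m t"
    and mass_small: "m 0 * (l + L + (2 * L + l)\<^sup>2 / (2 * \<mu>) + \<mu> / 2) \<le> 3 / 4"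
begin

lemma rates_nonneg: "L \<ge> 0" "l \<ge> 0"
proof -
  show "L \<ge> 0" using lipschitz lipschitz_on_nonneg by blast
  show "l \<ge> 0" using mass_deriv[of 1] mass_pos[of 1] 
    by (metis abs_ge_zero less_eq_real_def not_less order_trans zero_le_mult_iff zero_less_one)
qed

lemma mass_small_at:
  assumes "t \<ge> 0"
  shows "m t * (l + L + (2 * L + l)\<^sup>2 / (2 * \<mu>) + \<mu> / 2) \<le> 3 / 4"
proof -
  have "m t \<le> m 0" using mass_antimono assms by (auto simp: monotone_on_def)
  then have "m t * (l + L + (2 * L + l)\<^sup>2 / (2 * \<mu>) + \<mu> / 2) \<le> m 0 * (l + L + (2 * L + l)\<^sup>2 / (2 * \<mu>) + \<mu> / 2)"
    using rates_nonneg \<mu> by (intro mult_right_mono) auto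
  then show ?thesis using mass_small by linarith
qed

text \<open>On \<open>[s, t]\<close> the decreasing mass in the forcing term of \<open>gap_dissipation\<close> is replaced by its
  value at \<open>s\<close>, which leaves a constant for \<open>exponential_comparison\<close>.\<close>

lemma gap_decay:
  assumes x: "cadlag_path x" and gflow: "solves_gradient_flow \<Phi> x \<theta>"
    and mflow: "solves_momentum_flow \<Phi> m x p q"
    and G: "\<And>t. t \<ge> 0 \<Longrightarrow> norm (grad (\<Phi> (x t)) (\<theta> t)) \<le> G"
    and "0 \<le> s" "s \<le> t"
  defines "V \<equiv> \<lambda>t. (norm (q t + m t *\<^sub>R p t - \<theta> t))\<^sup>2 + (norm (m t *\<^sub>R p t))\<^sup>2"
  shows "V t \<le> exp (- \<mu> * (t - s)) * V s + 2 * G\<^sup>2 * m s / \<mu>"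
proof -
  define w where "w = (\<lambda>u. m u *\<^sub>R p u)"
  define e where "e = (\<lambda>u. q u + m u *\<^sub>R p u - \<theta> u)"
  define g where "g = (\<lambda>u. grad (\<Phi> (x u)))"
  define w' where "w' = (\<lambda>u. deriv m u *\<^sub>R p u - p u - g u (q u))"
  define e' where "e' = (\<lambda>u. deriv m u *\<^sub>R p u - g u (q u) + g u (\<theta> u))"
  have V: "V = (\<lambda>u. e u \<bullet> e u + w u \<bullet> w u)"
    by (simp only: V_def e_def w_def power2_norm_eq_inner)
  have "continuous_on {0..} q"
    by (rule momentum_flow_position_continuous[OF mflow])
  moreover have "continuous_on {0..} m"
    by (intro differentiable_imp_continuous_on mass_differentiable)
  moreover have "continuous_on {0..} p" "continuous_on {0..} \<theta>"
    using mflow gflow by (auto simp: solves_momentum_flow_def solves_gradient_flow_def)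
  ultimately have "continuous_on {0..} V"
    unfolding V_def by (intro continuous_intros)
  then have cont: "continuous_on {s..t} V"
    by (rule continuous_on_subset) (use \<open>0 \<le> s\<close> in auto)
  show ?thesis
  proof (rule exponential_comparison[where S = "jumps x \<inter> {..t}" and f' = "\<lambda>u. 2 * (e u \<bullet> e' u + w u \<bullet> w' u)"])
    fix u assume "u \<in> {s<..<t} - jumps x \<inter> {..t}"
    then have u: "u > 0" "u \<notin> jumps x" "s < u" using \<open>0 \<le> s\<close> by auto
    note at_u = at_within_nonneg[OF u(1)]
    have dq: "(q has_vector_derivative p u) (at u)"
      using mflow u by (force simp: solves_momentum_flow_def at_u[symmetric])
    obtain p' where dp: "(p has_vector_derivative p') (at u)" and p': "m u *\<^sub>R p' = - g u (q u) - p u"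
      using mflow u at_u by (force simp: solves_momentum_flow_def g_def)
    have d\<theta>: "(\<theta> has_vector_derivative - g u (\<theta> u)) (at u)"
      unfolding g_def by (rule gradient_flow_derivative[OF gflow u(1,2)])
    have "m differentiable (at u within {0..})"
      using mass_differentiable u(1) unfolding differentiable_on_def by (meson atLeast_iff less_imp_le)
    then have "m differentiable (at u)" by (simp add: at_u)
    then have dm: "(m has_vector_derivative deriv m u) (at u)"
      using DERIV_deriv_iff_real_differentiable has_real_derivative_iff_has_vector_derivative by blast
    have "(w has_vector_derivative m u *\<^sub>R p' + deriv m u *\<^sub>R p u) (at u)"
      unfolding w_def
      using bounded_bilinear.has_vector_derivative[OF bounded_bilinear_scaleR dm dp] .
    then have dw: "(w has_vector_derivative w' u) (at u)"
      by (simp add: w'_def p' algebra_simps)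
    have "((\<lambda>u. q u + w u - \<theta> u) has_vector_derivative p u + w' u - (- g u (\<theta> u))) (at u)"
      by (intro has_vector_derivative_add has_vector_derivative_diff dq dw d\<theta>)
    then have de: "(e has_vector_derivative e' u) (at u)"
      by (simp add: e_def w_def w'_def e'_def algebra_simps)
    have "(V has_vector_derivative (e u \<bullet> e' u + e' u \<bullet> e u) + (w u \<bullet> w' u + w' u \<bullet> w u)) (at u)"
      unfolding V
      by (intro has_vector_derivative_add bounded_bilinear.has_vector_derivative[OF bounded_bilinear_inner] de dw)
    then show "(V has_real_derivative 2 * (e u \<bullet> e' u + w u \<bullet> w' u)) (at u)"
      by (simp add: has_real_derivative_iff_has_vector_derivative inner_commute algebra_simps)
    have "2 * (e u \<bullet> e' u + w u \<bullet> w' u) \<le> - \<mu> * V u + 2 * G\<^sup>2 * m u"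
      unfolding e'_def w'_def V power2_norm_eq_inner[symmetric]
    proof (rule gap_dissipation[where l = l and L = L and gz = "g u (q u + w u)" and q = "q u" and \<theta> = "\<theta> u"])
      show "\<mu> * (norm (e u))\<^sup>2 \<le> e u \<bullet> (g u (q u + w u) - g u (\<theta> u))"
        using strongly_convex[of "x u", unfolded strongly_convex_def, rule_format, of "q u + w u" "\<theta> u"]
        by (simp add: e_def w_def g_def)
      show "norm (g u (q u + w u) - g u (q u)) \<le> L * norm (w u)"
        using lipschitz_onD[OF lipschitz[of "x u"], of "q u + w u" "q u"] by (simp add: g_def dist_norm)
      show "norm (g u (q u) - g u (\<theta> u)) \<le> L * norm (q u - \<theta> u)"
        using lipschitz_onD[OF lipschitz[of "x u"], of "q u" "\<theta> u"] by (simp add: g_def dist_norm)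
      show "norm (g u (\<theta> u)) \<le> G" using G[of u] u by (simp add: g_def)
    qed (use \<mu> rates_nonneg mass_pos mass_deriv mass_small_at u in \<open>auto simp: e_def w_def\<close>)
    also have "m u \<le> m s"
      using mass_antimono u \<open>0 \<le> s\<close> by (auto simp: monotone_on_def)
    finally show "2 * (e u \<bullet> e' u + w u \<bullet> w' u) \<le> - \<mu> * V u + 2 * G\<^sup>2 * m s"
      by (simp add: mult_left_mono)
  qed (use \<mu> mass_pos[of s] assms(5,6) cont in \<open>auto simp: finite_jumps_Int_atMost[OF x]\<close>)
qed

text \<open>The decay is used twice: over \<open>[0, t / 2]\<close> it only shows that the gap stays bounded, and over
  \<open>[t / 2, t]\<close> it forgets this bound exponentially fast while the forcing is already as small as
  \<open>m (t / 2)\<close>. Quantifying over the paths after \<open>F\<close> and \<open>B\<close> expresses that these are the same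
  for all index paths once the initial values are given.\<close>

lemma uniform_gap_bound:
  fixes p0 q0 \<theta>0 :: 'a
  obtains F B where "(F \<longlongrightarrow> 0) at_top" and "\<And>t. t \<ge> 0 \<Longrightarrow> F t \<le> B"
    and "\<And>x p q \<theta> t. \<lbrakk>cadlag_path x; solves_gradient_flow \<Phi> x \<theta>; solves_momentum_flow \<Phi> m x p q;
          p 0 = p0; q 0 = q0; \<theta> 0 = \<theta>0; t \<ge> 0\<rbrakk> \<Longrightarrow> norm (q t - \<theta> t) \<le> F t"
proof -
  define A where "A = (\<Sum>a\<in>UNIV. norm (grad (\<Phi> a) 0))"
  define G where "G = A + L * sqrt ((norm \<theta>0)\<^sup>2 + (A / \<mu>)\<^sup>2)"
  define V0 where "V0 = (norm (q0 + m 0 *\<^sub>R p0 - \<theta>0))\<^sup>2 + (norm (m 0 *\<^sub>R p0))\<^sup>2"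
  define b where "b = 2 * G\<^sup>2 / \<mu>"
  define H where "H = (\<lambda>t. exp (- \<mu> * (t / 2)) * (V0 + b * m 0) + b * m (t / 2))"
  define F where "F = (\<lambda>t. sqrt (2 * H t))"
  have b: "b \<ge> 0" using \<mu> by (simp add: b_def)
  have V0: "V0 \<ge> 0" by (simp add: V0_def)
  have half: "filterlim (\<lambda>t::real. t / 2) at_top at_top"
    by real_asymp
  have "((\<lambda>t. exp (- \<mu> * (t / 2))) \<longlongrightarrow> 0) at_top"
    using \<mu> by real_asymp
  moreover have "((\<lambda>t. m (t / 2)) \<longlongrightarrow> 0) at_top"
    by (rule filterlim_compose[OF mass_tendsto half])
  ultimately have "(F \<longlongrightarrow> sqrt (2 * (0 * (V0 + b * m 0) + b * 0))) at_top"
    unfolding F_def H_def by (intro tendsto_intros)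
  then have F: "(F \<longlongrightarrow> 0) at_top" by simp
  have bound: "F t \<le> sqrt (2 * (1 * (V0 + b * m 0) + b * m 0))" if "t \<ge> 0" for t
    unfolding F_def H_def
    using that b V0 \<mu> mass_pos[of 0] mass_antimono
    by (intro real_sqrt_le_mono mult_left_mono add_mono mult_right_mono) (auto simp: monotone_on_def)
  have A: "norm (grad (\<Phi> a) 0) \<le> A" for a
    unfolding A_def by (rule member_le_sum) auto
  have gap: "norm (q t - \<theta> t) \<le> F t"
    if x: "cadlag_path x" and gflow: "solves_gradient_flow \<Phi> x \<theta>"
      and mflow: "solves_momentum_flow \<Phi> m x p q"
      and init: "p 0 = p0" "q 0 = q0" "\<theta> 0 = \<theta>0" and "t \<ge> 0" for x p q \<theta> t
  proof -
    have G: "norm (grad (\<Phi> (x u)) (\<theta> u)) \<le> G" if "u \<ge> 0" for u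
    proof -
      have "norm (grad (\<Phi> (x u)) (\<theta> u)) \<le> norm (grad (\<Phi> (x u)) 0) + norm (grad (\<Phi> (x u)) (\<theta> u) - grad (\<Phi> (x u)) 0)"
        by (rule norm_triangle_sub)
      also have "\<dots> \<le> A + L * norm (\<theta> u)"
        using lipschitz_onD[OF lipschitz[of "x u"], of "\<theta> u" 0] A[of "x u"] by (simp add: dist_norm)
      also have "norm (\<theta> u) \<le> sqrt ((norm \<theta>0)\<^sup>2 + (A / \<mu>)\<^sup>2)"
        using gradient_flow_bounded[OF x gflow A that] init by (intro real_le_rsqrt) simp
      finally show ?thesis
        using rates_nonneg by (simp add: G_def mult_left_mono)
    qed
    define V where "V = (\<lambda>t. (norm (q t + m t *\<^sub>R p t - \<theta> t))\<^sup>2 + (norm (m t *\<^sub>R p t))\<^sup>2)"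
    have decay: "V v \<le> exp (- \<mu> * (v - u)) * V u + 2 * G\<^sup>2 * m u / \<mu>" if "0 \<le> u" "u \<le> v" for u v
      unfolding V_def using gap_decay[OF x gflow mflow G that] .
    have "V (t / 2) \<le> exp (- \<mu> * (t / 2)) * V 0 + b * m 0"
      using decay[of 0 "t / 2"] \<open>t \<ge> 0\<close> by (simp add: b_def)
    also have "\<dots> \<le> 1 * V 0 + b * m 0"
      using \<mu> \<open>t \<ge> 0\<close> by (intro add_right_mono mult_right_mono) (auto simp: V_def)
    also have "V 0 = V0" by (simp add: V_def V0_def init)
    finally have start: "V (t / 2) \<le> V0 + b * m 0" by simp
    have "V t \<le> exp (- \<mu> * (t - t / 2)) * V (t / 2) + b * m (t / 2)"
      using decay[of "t / 2" t] \<open>t \<ge> 0\<close> by (simp add: b_def)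
    also have "\<dots> \<le> exp (- \<mu> * (t - t / 2)) * (V0 + b * m 0) + b * m (t / 2)"
      using start by simp
    finally have VH: "V t \<le> H t" by (simp add: H_def)
    have "norm (q t - \<theta> t) \<le> norm (q t + m t *\<^sub>R p t - \<theta> t) + norm (m t *\<^sub>R p t)"
      using norm_triangle_ineq4[of "q t + m t *\<^sub>R p t - \<theta> t" "m t *\<^sub>R p t"] by simp
    also have "\<dots> \<le> sqrt (2 * V t)"
      unfolding V_def using sum_squares_bound[of "norm (q t + m t *\<^sub>R p t - \<theta> t)" "norm (m t *\<^sub>R p t)"]
      by (intro real_le_rsqrt) (simp add: power2_sum)
    finally show ?thesis using VH by (simp add: F_def real_sqrt_le_mono order_trans)
  qed
  show thesis using that[of F] F bound gap by blast
qed

end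

text \<open>The fraction \<open>\<mu>\<^sup>2 / (2 \<gamma> N + \<mu>)\<^sup>2\<close> is at most \<open>1\<close>, so \<open>m \<le> 1 / (4 C\<^sup>2)\<close> with
  \<open>C = C2_L_mu L \<mu>\<close>. Each of \<open>l + L\<close>, \<open>(2 L + l)\<^sup>2 / (2 \<mu>)\<close> and \<open>\<mu>\<close> is below \<open>C\<^sup>2\<close>, thanks to the summands
  \<open>C1_L L\<close>, \<open>2 * C2_L L / \<mu>\<close> and \<open>\<mu> powr (1/2)\<close> of \<open>C\<close>, respectively.\<close>

lemma mass_smallness:
  assumes \<mu>: "\<mu> > 0" and L: "L > 0" and \<gamma>: "\<gamma> \<ge> 0" and m: "m > 0" 
    and le: "m \<le> C2_L_mu L \<mu> powi (-2) * \<mu>\<^sup>2 / (4 * (2 * \<gamma> * real N + \<mu>)\<^sup>2)"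
    and l: "0 \<le> l" "l \<le> 1 / 4"
  shows "m * (l + L + (2 * L + l)\<^sup>2 / (2 * \<mu>) + \<mu> / 2) \<le> 3 / 4"
proof -
  define P where "P = C1_L L"
  define C where "C = C2_L_mu L \<mu>"
  define r where "r = sqrt \<mu>"
  have r: "r > 0" "r\<^sup>2 = \<mu>" "\<mu> powr (1/2) = r" "\<mu> powr - (1/2) = 1 / r"
    using \<mu> powr_minus[of \<mu> "1/2"] by (auto simp: r_def powr_half_sqrt divide_simps)
  have P: "P \<ge> 1" "L + 1/4 \<le> P" "2 * L + 1/4 \<le> P"
    using L by (auto simp: P_def C1_L_def intro: add_nonneg_nonneg)
  have C: "C = 16 * P\<^sup>2 / r * (1 + 1 / r + r) + r + P"
    by (simp add: C_def C2_L_mu_def C1_L_mu_def r C2_L_def P_def C1_L_def)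
  have "16 * P\<^sup>2 / r * (1 / r) \<le> 16 * P\<^sup>2 / r * (1 + 1 / r + r)"
    using r(1) by (intro mult_left_mono) auto
  then have "16 * P\<^sup>2 / \<mu> \<le> 16 * P\<^sup>2 / r * (1 + 1 / r + r)"
    by (simp add: r(2)[symmetric] power2_eq_square)
  moreover have "16 * P\<^sup>2 / \<mu> \<ge> 0" using \<mu> by simp
  ultimately have CP: "C \<ge> P" "C \<ge> r" "C \<ge> 16 * P\<^sup>2 / \<mu>"
    using r(1) P(1) unfolding C by linarith+
  have C1: "C \<ge> 1" using CP(1) P(1) by linarith
  then have CC: "C \<le> C\<^sup>2" by (simp add: power2_eq_square)
  have "\<mu> \<le> C\<^sup>2" using power_mono[OF CP(2), of 2] r by simp
  moreover have "l + L \<le> C\<^sup>2" using l P(2) CP(1) CC by linarith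
  moreover have "(2 * L + l)\<^sup>2 / (2 * \<mu>) \<le> C\<^sup>2"
  proof -
    have "(2 * L + l)\<^sup>2 \<le> P\<^sup>2" using P l L by (intro power_mono) auto
    then have "(2 * L + l)\<^sup>2 / (2 * \<mu>) \<le> P\<^sup>2 / (2 * \<mu>)" using \<mu> by (simp add: divide_right_mono)
    also have "\<dots> \<le> 16 * P\<^sup>2 / \<mu>" using \<mu> by (simp add: field_simps)
    finally show ?thesis using CP(3) CC by linarith
  qed
  moreover have "C\<^sup>2 > 0" using C1 by simp
  ultimately have \<kappa>: "l + L + (2 * L + l)\<^sup>2 / (2 * \<mu>) + \<mu> / 2 \<le> 3 * C\<^sup>2"
    by linarith
  have "\<mu>\<^sup>2 \<le> (2 * \<gamma> * real N + \<mu>)\<^sup>2"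
    using \<mu> \<gamma> by (intro power_mono) auto
  moreover have "(2 * \<gamma> * real N + \<mu>)\<^sup>2 > 0"
    using \<mu> \<gamma> by (intro zero_less_power add_nonneg_pos) auto
  ultimately have "inverse (C\<^sup>2) * \<mu>\<^sup>2 / (4 * (2 * \<gamma> * real N + \<mu>)\<^sup>2) \<le> inverse (C\<^sup>2) / 4"
    using C1 by (simp add: field_simps)
  then have "m \<le> inverse (C\<^sup>2) / 4"
    using le by (simp add: C_def power_int_minus)
  then have "m * (l + L + (2 * L + l)\<^sup>2 / (2 * \<mu>) + \<mu> / 2) \<le> inverse (C\<^sup>2) / 4 * (3 * C\<^sup>2)"
    using \<kappa> m l L \<mu> by (intro mult_mono) auto
  also have "\<dots> = 3 / 4" using \<open>C\<^sup>2 > 0\<close> by (simp add: field_simps)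
  finally show ?thesis .
qed


section \<open>Measurability at jump times\<close>

lemma jump_time_measurable:
  fixes X :: "real \<Rightarrow> 'w \<Rightarrow> 'n::finite"
  assumes X: "\<And>t. t \<ge> 0 \<Longrightarrow> X t \<in> measurable M (count_space UNIV)"
    and x: "\<And>\<omega>. \<omega> \<in> space M \<Longrightarrow> cadlag_path (\<lambda>t. X t \<omega>)"
  shows "(\<lambda>\<omega>. jump_time (\<lambda>t. X t \<omega>) n) \<in> borel_measurable M"
proof (induction n)
  case (Suc n)
  define \<tau> where "\<tau> = (\<lambda>\<omega>. jump_time (\<lambda>t. X t \<omega>) n)"
  define J where "J = (\<lambda>\<omega>. jumps (\<lambda>t. X t \<omega>))"
  have \<tau>[measurable]: "\<tau> \<in> borel_measurable M" using Suc by (simp add: \<tau>_def)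
  have E[measurable]: "{\<omega> \<in> space M. J \<omega> \<inter> {\<tau> \<omega><..<c} \<noteq> {}} \<in> sets M" for c
  proof -
    let ?R = "\<rat> \<inter> {0::real..}"
    have "{\<omega> \<in> space M. J \<omega> \<inter> {\<tau> \<omega><..<c} \<noteq> {}} = (\<Union>r\<in>?R. \<Union>s\<in>?R.
        {\<omega> \<in> space M. \<tau> \<omega> < r \<and> r < c \<and> \<tau> \<omega> < s \<and> s < c \<and> X r \<omega> \<noteq> X s \<omega>})"
      (is "?A = ?B")
    proof (intro set_eqI iffI)
      fix \<omega> assume "\<omega> \<in> ?A"
      then have \<omega>: "\<omega> \<in> space M" "J \<omega> \<inter> {\<tau> \<omega><..<c} \<noteq> {}" by auto
      have "\<tau> \<omega> \<ge> 0" by (simp add: \<tau>_def jump_time_nonneg)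
      with \<omega> obtain r s where "r \<in> \<rat>" "s \<in> \<rat>" "\<tau> \<omega> < r" "r < c" "\<tau> \<omega> < s" "s < c" "X r \<omega> \<noteq> X s \<omega>"
        using jump_between_iff_rat[OF x[OF \<omega>(1)]] unfolding J_def by blast
      then show "\<omega> \<in> ?B" using \<omega>(1) \<open>\<tau> \<omega> \<ge> 0\<close> by (intro UN_I[of r] UN_I[of s]) auto
    next
      fix \<omega> assume "\<omega> \<in> ?B"
      then obtain r s where \<omega>: "\<omega> \<in> space M" and
        "r \<in> \<rat>" "s \<in> \<rat>" "\<tau> \<omega> < r" "r < c" "\<tau> \<omega> < s" "s < c" "X r \<omega> \<noteq> X s \<omega>" by blast
      moreover have "\<tau> \<omega> \<ge> 0" by (simp add: \<tau>_def jump_time_nonneg)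
      ultimately show "\<omega> \<in> ?A"
        using jump_between_iff_rat[OF x[OF \<omega>]] unfolding J_def by blast
    qed
    also have "\<dots> \<in> sets M"
    proof (intro sets.countable_UN'')
      fix r s :: real assume "r \<in> ?R" "s \<in> ?R"
      then have [measurable]: "X r \<in> measurable M (count_space UNIV)" "X s \<in> measurable M (count_space UNIV)"
        using X by auto
      show "{\<omega> \<in> space M. \<tau> \<omega> < r \<and> r < c \<and> \<tau> \<omega> < s \<and> s < c \<and> X r \<omega> \<noteq> X s \<omega>} \<in> sets M"
        by measurable
    qed (auto intro: countable_rat countable_subset)
    finally show ?thesis .
  qed
  have [measurable]: "Measurable.pred M (\<lambda>\<omega>. J \<omega> \<inter> {\<tau> \<omega><..<c} \<noteq> {})" for c
    using E[of c] by (simp add: pred_def)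
  \<comment> \<open>The second alternative covers the paths without a further jump, where the last jump time is
    repeated; integer bounds \<open>k\<close> express "no further jump" by countably many events.\<close>
  have less: "jump_time (\<lambda>t. X t \<omega>) (Suc n) < c \<longleftrightarrow> J \<omega> \<inter> {\<tau> \<omega><..<c} \<noteq> {} \<or>
      ((\<forall>k::nat. \<not> J \<omega> \<inter> {\<tau> \<omega><..<real k} \<noteq> {}) \<and> \<tau> \<omega> < c)" for \<omega> c
  proof (cases "J \<omega> \<inter> {\<tau> \<omega><..} = {}")
    case True
    then show ?thesis by (auto simp: J_def \<tau>_def)
  next
    case False
    then obtain u where "u \<in> J \<omega>" "\<tau> \<omega> < u" by auto
    moreover obtain k :: nat where "u < k" using reals_Archimedean2 by blast
    ultimately have k: "J \<omega> \<inter> {\<tau> \<omega><..<real k} \<noteq> {}" by auto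
    have "bdd_below (J \<omega> \<inter> {\<tau> \<omega><..})" by (rule bdd_belowI[of _ "\<tau> \<omega>"]) auto
    then have "Inf (J \<omega> \<inter> {\<tau> \<omega><..}) < c \<longleftrightarrow> J \<omega> \<inter> {\<tau> \<omega><..<c} \<noteq> {}"
      using cInf_less_iff[OF False] by auto
    then show ?thesis using False k by (auto simp: J_def \<tau>_def)
  qed
  show ?case
    unfolding borel_measurable_iff_less less by (rule allI) measurable
qed simp

text \<open>The random time is rounded up to a multiple of \<open>1 / Suc k\<close>: a process sampled at a countably-valued time
  is measurable, and continuity of the paths passes this to the limit. Rounding up keeps the time in
  the half-line on which the process is given.\<close>

lemma borel_measurable_at_random_time:
  fixes Y :: "real \<Rightarrow> 'w \<Rightarrow> 'b::metric_space"
  assumes Y: "\<And>t. t \<ge> 0 \<Longrightarrow> Y t \<in> borel_measurable M"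
    and cont: "\<And>\<omega>. \<omega> \<in> space M \<Longrightarrow> continuous_on {0..} (\<lambda>t. Y t \<omega>)"
    and \<sigma>[measurable]: "\<sigma> \<in> borel_measurable M" and nonneg: "\<And>\<omega>. \<omega> \<in> space M \<Longrightarrow> \<sigma> \<omega> \<ge> 0"
  shows "(\<lambda>\<omega>. Y (\<sigma> \<omega>) \<omega>) \<in> borel_measurable M"
proof (rule borel_measurable_LIMSEQ_metric)
  define r where "r = (\<lambda>k \<omega>. real (nat \<lceil>\<sigma> \<omega> * real (Suc k)\<rceil>) / real (Suc k))"
  show "(\<lambda>\<omega>. Y (r k \<omega>) \<omega>) \<in> borel_measurable M" for k
    unfolding r_def
    by (rule measurable_compose_countable[where f = "\<lambda>j. Y (real j / real (Suc k))"]) (auto intro: Y)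
  fix \<omega> assume \<omega>: "\<omega> \<in> space M"
  have bounds: "\<sigma> \<omega> \<le> r k \<omega>" "r k \<omega> \<le> \<sigma> \<omega> + 1 / real (Suc k)" for k
  proof -
    have "real (nat \<lceil>\<sigma> \<omega> * real (Suc k)\<rceil>) = of_int \<lceil>\<sigma> \<omega> * real (Suc k)\<rceil>"
    proof (rule of_nat_nat)
      have "0 \<le> \<sigma> \<omega> * real (Suc k)" using nonneg[OF \<omega>] by simp
      then show "0 \<le> \<lceil>\<sigma> \<omega> * real (Suc k)\<rceil>" by linarith
    qed
    then have "\<sigma> \<omega> * real (Suc k) \<le> real (nat \<lceil>\<sigma> \<omega> * real (Suc k)\<rceil>)"
      "real (nat \<lceil>\<sigma> \<omega> * real (Suc k)\<rceil>) \<le> \<sigma> \<omega> * real (Suc k) + 1"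
      by linarith+
    then show "\<sigma> \<omega> \<le> r k \<omega>" "r k \<omega> \<le> \<sigma> \<omega> + 1 / real (Suc k)"
      unfolding r_def by (simp_all add: field_simps del: of_nat_Suc)
  qed
  have "(\<lambda>k. \<sigma> \<omega> + 1 / real (Suc k)) \<longlonglongrightarrow> \<sigma> \<omega> + 0"
    by (intro tendsto_intros LIMSEQ_inverse_real_of_nat[unfolded inverse_eq_divide])
  then have "(\<lambda>k. \<sigma> \<omega> + 1 / real (Suc k)) \<longlonglongrightarrow> \<sigma> \<omega>" by simp
  then have "(\<lambda>k. r k \<omega>) \<longlonglongrightarrow> \<sigma> \<omega>"
    by (rule tendsto_sandwich[OF _ _ tendsto_const, rotated 2]) (auto simp: bounds simp del: of_nat_Suc)
  then show "(\<lambda>k. Y (r k \<omega>) \<omega>) \<longlonglongrightarrow> Y (\<sigma> \<omega>) \<omega>"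
  proof (rule continuous_on_tendsto_compose[OF cont[OF \<omega>]])
    show "\<forall>\<^sub>F k in sequentially. r k \<omega> \<in> {0..}"
      using order_trans[OF nonneg[OF \<omega>] bounds(1)] by simp
  qed (use nonneg[OF \<omega>] in auto)
qed

section \<open>The index process never stops jumping\<close>

text \<open>With \<open>J\<close> the matrix of ones, \<open>rate_matrix \<gamma> = \<gamma> (J - N I)\<close>, and \<open>J\<^sup>2 = N J\<close>. So the rate matrix
  is a multiple of a projection, and its exponential series reduces to a scalar series.\<close>

lemma rate_matrix_square:
  "(rate_matrix \<gamma> :: real ^ 'n ^ 'n) ** rate_matrix \<gamma> = (- real CARD('n) * \<gamma>) *\<^sub>R rate_matrix \<gamma>"
proof -
  define c where "c = real CARD('n) * \<gamma>"
  have entry: "(rate_matrix \<gamma> :: real ^ 'n ^ 'n) $ a $ b = \<gamma> - (if a = b then c else 0)" for a b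
    by (simp add: rate_matrix_def mat_def c_def)
  have "(\<Sum>j\<in>UNIV. (\<gamma> - (if a = j then c else 0)) * (\<gamma> - (if j = b then c else 0)))
      = - c * (\<gamma> - (if a = b then c else 0))" for a b :: 'n
  proof -
    have "(\<Sum>j\<in>UNIV. (\<gamma> - (if a = j then c else 0)) * (\<gamma> - (if j = b then c else 0)))
      = (\<Sum>j\<in>UNIV. \<gamma>\<^sup>2 - (if j = b then \<gamma> * c else 0) - (if a = j then c * (\<gamma> - (if j = b then c else 0)) else 0))"
      by (intro sum.cong) (auto simp: algebra_simps power2_eq_square)
    also have "\<dots> = real CARD('n) * \<gamma>\<^sup>2 - \<gamma> * c - c * (\<gamma> - (if a = b then c else 0))"
      by (simp add: sum_subtractf)
    also have "real CARD('n) * \<gamma>\<^sup>2 = \<gamma> * c" by (simp add: c_def power2_eq_square)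
    finally show ?thesis by simp
  qed
  then show ?thesis
    by (simp add: vec_eq_iff matrix_matrix_mult_def entry) (simp add: c_def)
qed

lemma matrix_exp_rate_matrix:
  assumes "\<gamma> > 0"
  defines "c \<equiv> real CARD('n) * \<gamma>"
  shows "matrix_exp (h *\<^sub>R rate_matrix \<gamma> :: real ^ 'n ^ 'n)
    = mat 1 + ((1 - exp (- h * c)) / c) *\<^sub>R rate_matrix \<gamma>"
proof -
  define Q where "Q = (rate_matrix \<gamma> :: real ^ 'n ^ 'n)"
  have c: "c > 0" using \<open>\<gamma> > 0\<close> by (simp add: c_def)
  have QQ: "Q ** Q = (- c) *\<^sub>R Q"
    unfolding Q_def c_def using rate_matrix_square by simp
  have scaled: "(a *\<^sub>R A) ** (b *\<^sub>R B) = (a * b) *\<^sub>R (A ** B)" for a b and A B :: "real ^ 'n ^ 'n"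
    by (simp add: vec_eq_iff matrix_matrix_mult_def sum_distrib_left mult_ac)
  have power: "((**) (h *\<^sub>R Q) ^^ Suc k) (mat 1) = ((- h * c) ^ Suc k * (- 1 / c)) *\<^sub>R Q" for k
  proof (induction k)
    case 0
    then show ?case using c by simp
  next
    case (Suc k)
    have "((**) (h *\<^sub>R Q) ^^ Suc (Suc k)) (mat 1) = (h *\<^sub>R Q) ** (((- h * c) ^ Suc k * (- 1 / c)) *\<^sub>R Q)"
      using Suc by simp
    also have "\<dots> = (h * ((- h * c) ^ Suc k * (- 1 / c))) *\<^sub>R (- c) *\<^sub>R Q"
      by (simp only: scaled QQ)
    also have "\<dots> = ((- h * c) ^ Suc (Suc k) * (- 1 / c)) *\<^sub>R Q"
      by simp
    finally show ?case .
  qed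
  \<comment> \<open>The closed form for positive powers gives \<open>- Q / c\<close> instead of \<open>mat 1\<close> at the exponent \<open>0\<close>; the
    last summand corrects this.\<close>
  have terms: "(1 / fact k) *\<^sub>R (((**) (h *\<^sub>R Q) ^^ k) (mat 1))
      = ((- h * c) ^ k /\<^sub>R fact k) *\<^sub>R ((- 1 / c) *\<^sub>R Q) + (if k = 0 then mat 1 + (1 / c) *\<^sub>R Q else 0)" for k
  proof (cases k)
    case 0
    then show ?thesis by simp
  next
    case (Suc j)
    then show ?thesis unfolding Suc power by (simp add: divide_inverse)
  qed
  have "(\<lambda>k. (1 / fact k) *\<^sub>R (((**) (h *\<^sub>R Q) ^^ k) (mat 1))) sums
      (exp (- h * c) *\<^sub>R ((- 1 / c) *\<^sub>R Q) + (mat 1 + (1 / c) *\<^sub>R Q))"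
    unfolding terms
    by (intro sums_add sums_scaleR_left exp_converges sums_single)
  then have "matrix_exp (h *\<^sub>R Q) = exp (- h * c) *\<^sub>R ((- 1 / c) *\<^sub>R Q) + (mat 1 + (1 / c) *\<^sub>R Q)"
    unfolding matrix_exp_def by (rule sums_unique[symmetric])
  also have "\<dots> = mat 1 + ((1 - exp (- h * c)) / c) *\<^sub>R Q"
    by (simp add: algebra_simps diff_divide_distrib)
  finally show ?thesis by (simp add: Q_def)
qed

lemma matrix_exp_rate_matrix_diagonal_less_1:
  assumes "\<gamma> > 0" "h > 0" "CARD('n) \<ge> 2"
  shows "matrix_exp (h *\<^sub>R rate_matrix \<gamma> :: real ^ 'n ^ 'n) $ a $ a < 1"
proof -
  define c where "c = real CARD('n) * \<gamma>"
  have c: "c > 0" "\<gamma> < c" using assms by (auto simp: c_def)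
  have "exp (- h * c) < 1" using c assms by simp
  then have "(1 - exp (- h * c)) / c * (\<gamma> - c) < 0"
    using c by (intro mult_pos_neg divide_pos_pos) auto
  then show ?thesis
    using matrix_exp_rate_matrix[OF \<open>\<gamma> > 0\<close>, where 'n = 'n, of h]
    by (simp add: mat_def rate_matrix_def c_def)
qed

lemma markov_process_transition:
  assumes "markov_process M Q X" "finite T" "T \<subseteq> {0..s}" "0 \<le> s" "0 \<le> h"
    and "\<P>(\<omega> in M. X s \<omega> = a \<and> (\<forall>u\<in>T. X u \<omega> = x u)) > 0"
  shows "\<P>(\<omega> in M. X (s + h) \<omega> = b \<bar> X s \<omega> = a \<and> (\<forall>u\<in>T. X u \<omega> = x u))
    = matrix_exp (h *\<^sub>R Q) $ a $ b"
  using assms unfolding markov_process_def by blast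

text \<open>A path without jumps after \<open>T\<close> shows the same state \<open>a\<close> at the times \<open>T + 1, T + 2, \<dots>\<close>. By the Markov
  property, the probability of this up to the \<open>k\<close>-th step decays like the \<open>k\<close>-th power of the
  probability to be in \<open>a\<close> again after one unit of time.\<close>

lemma AE_jump_after:
  fixes X :: "real \<Rightarrow> 'w \<Rightarrow> 'n::finite"
  assumes "prob_space M" and markov: "markov_process M Q X"
    and leave: "\<And>a. matrix_exp Q $ a $ a < 1" and "T \<ge> 0"
  shows "AE \<omega> in M. jumps (\<lambda>t. X t \<omega>) \<inter> {T<..} \<noteq> {}"
proof -
  interpret prob_space M by fact
  have X[measurable]: "X t \<in> measurable M (count_space UNIV)" if "t \<ge> 0" for t
    using markov that by (simp add: markov_process_def)
  define u where "u = (\<lambda>j::nat. T + 1 + real j)"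
  have u: "u j \<ge> 0" for j using \<open>T \<ge> 0\<close> by (simp add: u_def)
  define E where "E = (\<lambda>a k. {\<omega> \<in> space M. \<forall>j\<le>k. X (u j) \<omega> = a})"
  have E[measurable]: "E a k \<in> sets M" for a k
  proof -
    have [measurable]: "X (u j) \<in> measurable M (count_space UNIV)" for j by (rule X) (rule u)
    show ?thesis unfolding E_def by measurable
  qed
  have null: "(\<Inter>k. E a k) \<in> null_sets M" for a
  proof -
    \<comment> \<open>The entry is known to be a probability only if \<open>a\<close> is reached with positive probability.\<close>
    define r where "r = max 0 (matrix_exp Q $ a $ a)"
    have r: "0 \<le> r" "r < 1" using leave[of a] by (auto simp: r_def)
    have decay: "prob (E a k) \<le> r ^ k" for k
    proof (induction k)
      case 0
      then show ?case by simp
    next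
      case (Suc k)
      have hist: "X (u k) \<omega> = a \<and> (\<forall>v\<in>u ` {..k}. X v \<omega> = a) \<longleftrightarrow> (\<forall>j\<le>k. X (u j) \<omega> = a)" for \<omega>
        by auto
      have next_step: "X (u k + 1) \<omega> = a \<and> (\<forall>j\<le>k. X (u j) \<omega> = a) \<longleftrightarrow> (\<forall>j\<le>Suc k. X (u j) \<omega> = a)" for \<omega>
        by (auto simp: u_def le_Suc_eq add.assoc)
      show ?case
      proof (cases "prob (E a k) > 0")
        case True
        have "\<P>(\<omega> in M. X (u k + 1) \<omega> = a \<bar> X (u k) \<omega> = a \<and> (\<forall>v\<in>u ` {..k}. X v \<omega> = a))
            = matrix_exp (1 *\<^sub>R Q) $ a $ a"
          by (rule markov_process_transition[OF markov])
            (use True u in \<open>simp_all only: hist E_def\<close>, auto simp: u_def)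
        then have "prob (E a (Suc k)) / prob (E a k) = matrix_exp Q $ a $ a"
          unfolding cond_prob_def hist next_step E_def by simp
        then have "prob (E a (Suc k)) = matrix_exp Q $ a $ a * prob (E a k)"
          using True by (simp add: field_simps)
        also have "\<dots> \<le> r * r ^ k"
          using Suc r by (intro mult_mono) (auto simp: r_def)
        finally show ?thesis by simp
      next
        case False
        have "prob (E a (Suc k)) \<le> prob (E a k)"
          by (intro finite_measure_mono E) (auto simp: E_def)
        then show ?thesis using False r by (simp add: not_less order_trans[of _ 0])
      qed
    qed
    have "prob (\<Inter>k. E a k) \<le> r ^ k" for k
      using decay[of k] finite_measure_mono[of "\<Inter>k. E a k" "E a k"] E by (force intro: order_trans)
    moreover have "(\<lambda>k. r ^ k) \<longlonglongrightarrow> 0" using r by (intro LIMSEQ_realpow_zero) auto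
    ultimately have "prob (\<Inter>k. E a k) \<le> 0"
      by (intro LIMSEQ_le_const[of "\<lambda>k. r ^ k"]) auto
    then have "prob (\<Inter>k. E a k) = 0" using measure_nonneg order_antisym by blast
    then show ?thesis
      by (intro null_setsI) (auto simp: emeasure_eq_measure)
  qed
  show ?thesis
  proof (rule AE_I')
    show "(\<Union>a. \<Inter>k. E a k) \<in> null_sets M"
      using null by (intro null_sets_UN') (auto intro: countable_finite)
    show "{\<omega> \<in> space M. \<not> jumps (\<lambda>t. X t \<omega>) \<inter> {T<..} \<noteq> {}} \<subseteq> (\<Union>a. \<Inter>k. E a k)"
    proof
      fix \<omega> assume "\<omega> \<in> {\<omega> \<in> space M. \<not> jumps (\<lambda>t. X t \<omega>) \<inter> {T<..} \<noteq> {}}"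
      then have \<omega>: "\<omega> \<in> space M" and no: "jumps (\<lambda>t. X t \<omega>) \<inter> {T<..} = {}" by auto
      have "X (u j) \<omega> = X (u 0) \<omega>" for j
      proof (rule constant_between_jumps[where x = "\<lambda>t. X t \<omega>" and a = T and b = "u j + 1"])
        show "cadlag_path (\<lambda>t. X t \<omega>)" using markov \<omega> by (simp add: markov_process_def)
        show "jumps (\<lambda>t. X t \<omega>) \<inter> {T<..<u j + 1} = {}" using no by auto
      qed (use \<open>T \<ge> 0\<close> in \<open>auto simp: u_def\<close>)
      then show "\<omega> \<in> (\<Union>a. \<Inter>k. E a k)" using \<omega> unfolding E_def by blast
    qed
  qed
qed

section \<open>Convergence of the stochastic gradient-momentum process\<close>

theorem theorem15:
  fixes \<Phi> :: "'n::finite \<Rightarrow> real ^ 'k \<Rightarrow> real"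
    and \<theta>star :: "'n \<Rightarrow> real ^ 'k"
    and \<mu> L \<gamma> :: real
    and m :: "real \<Rightarrow> real"
    and M :: "'w measure"
    and i :: "real \<Rightarrow> 'w \<Rightarrow> 'n"
    and p q \<theta> :: "real \<Rightarrow> 'w \<Rightarrow> real ^ 'k"
    and p0 q0 \<theta>0 :: "real ^ 'k"
  assumes "\<mu> > 0" and "L > 0" and "\<gamma> > 0"
    and "\<And>a. C1_function (\<Phi> a)"
    and "\<And>a. strongly_convex \<mu> (\<Phi> a)"
    and "\<And>a. L-lipschitz_on UNIV (grad (\<Phi> a))"
    and "\<And>a. grad (\<Phi> a) (\<theta>star a) = 0"
    and "\<And>t. t \<ge> 0 \<Longrightarrow> m t > 0"
    and "strict_antimono_on {0..} m"
    and "m differentiable_on {0..}"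
    and "(m \<longlongrightarrow> 0) at_top"
    and "m 0 \<le> 1"
    and "\<And>t. t > 0 \<Longrightarrow> \<bar>deriv m t\<bar> \<le> min (\<mu> / 4) (1 / 4) * m t"
    and "prob_space M"
    and "index_process M \<gamma> i"
    and "\<And>t. t \<ge> 0 \<Longrightarrow> p t \<in> borel_measurable M"
    and "\<And>t. t \<ge> 0 \<Longrightarrow> q t \<in> borel_measurable M"
    and "\<And>t. t \<ge> 0 \<Longrightarrow> \<theta> t \<in> borel_measurable M"
    and "\<And>\<omega>. \<omega> \<in> space M \<Longrightarrow> p 0 \<omega> = p0 \<and> q 0 \<omega> = q0 \<and> \<theta> 0 \<omega> = \<theta>0"
    and "\<And>\<omega>. \<omega> \<in> space M \<Longrightarrow>
           solves_momentum_flow \<Phi> m (\<lambda>t. i t \<omega>) (\<lambda>t. p t \<omega>) (\<lambda>t. q t \<omega>)"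
    and "\<And>\<omega>. \<omega> \<in> space M \<Longrightarrow> solves_gradient_flow \<Phi> (\<lambda>t. i t \<omega>) (\<lambda>t. \<theta> t \<omega>)"
    and "m 0 \<le> C2_L_mu L \<mu> powi (-2) * \<mu>\<^sup>2 / (4 * (2 * \<gamma> * real CARD('n) + \<mu>)\<^sup>2)"
  defines "\<tau> \<equiv> \<lambda>n \<omega>. jump_time (\<lambda>t. i t \<omega>) n"
  shows "(CARD('n) \<ge> 2 \<longrightarrow>
            (\<forall>n\<ge>1. integrable M (\<lambda>\<omega>. norm (q (\<tau> n \<omega>) \<omega> - \<theta> (\<tau> n \<omega>) \<omega>))) \<and>
            (\<lambda>n. \<integral>\<omega>. norm (q (\<tau> n \<omega>) \<omega> - \<theta> (\<tau> n \<omega>) \<omega>) \<partial>M) \<longlonglongrightarrow> 0) \<and>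
         ((\<exists>C>0. \<exists>c>0. \<forall>t\<ge>0. m t \<le> C * exp (- c * t)) \<longrightarrow>
            (AE \<omega> in M. ((\<lambda>t. norm (q t \<omega> - \<theta> t \<omega>)) \<longlongrightarrow> 0) at_top) \<and>
            (\<forall>t\<ge>0. integrable M (\<lambda>\<omega>. norm (q t \<omega> - \<theta> t \<omega>))) \<and>
            ((\<lambda>t. \<integral>\<omega>. norm (q t \<omega> - \<theta> t \<omega>) \<partial>M) \<longlongrightarrow> 0) at_top)"
proof -
  interpret prob_space M by fact
  have markov: "markov_process M (rate_matrix \<gamma>) i"
    using assms(15) by (simp add: index_process_def)
  have path: "cadlag_path (\<lambda>t. i t \<omega>)" if "\<omega> \<in> space M" for \<omega>
    using markov that by (simp add: markov_process_def)
  interpret vanishing_mass \<Phi> \<mu> L m "min (\<mu> / 4) (1 / 4)"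
  proof
    show "antimono_on {0..} m"
      using assms(9) by (auto simp: monotone_on_def less_eq_real_def)
    show "m 0 * (min (\<mu> / 4) (1 / 4) + L + (2 * L + min (\<mu> / 4) (1 / 4))\<^sup>2 / (2 * \<mu>) + \<mu> / 2) \<le> 3 / 4"
      by (rule mass_smallness[OF assms(1,2) _ _ assms(22)]) (use assms(1,3,8) in auto)
  qed fact+
  obtain F B where F: "(F \<longlongrightarrow> 0) at_top" and B: "\<And>t. t \<ge> 0 \<Longrightarrow> F t \<le> B"
    and gap_le: "\<And>x p q \<theta> t. \<lbrakk>cadlag_path x; solves_gradient_flow \<Phi> x \<theta>;
      solves_momentum_flow \<Phi> m x p q; p 0 = p0; q 0 = q0; \<theta> 0 = \<theta>0; t \<ge> 0\<rbrakk>
      \<Longrightarrow> norm (q t - \<theta> t) \<le> F t"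
    by (rule uniform_gap_bound[of p0 q0 \<theta>0]) (rule that; blast)
  define gap where "gap = (\<lambda>t \<omega>. norm (q t \<omega> - \<theta> t \<omega>))"
  have gap_F: "gap t \<omega> \<le> F t" if "\<omega> \<in> space M" "t \<ge> 0" for t \<omega>
    unfolding gap_def by (rule gap_le[OF path assms(21,20)]) (use assms(19) that in auto)
  have gap_integrable: "integrable M (\<lambda>\<omega>. gap (\<sigma> \<omega>) \<omega>)"
    if "\<sigma> \<in> borel_measurable M" "\<And>\<omega>. \<omega> \<in> space M \<Longrightarrow> \<sigma> \<omega> \<ge> 0" for \<sigma>
  proof (rule integrable_const_bound)
    show "AE \<omega> in M. norm (gap (\<sigma> \<omega>) \<omega>) \<le> B"
    proof (rule AE_I2)
      fix \<omega> assume "\<omega> \<in> space M"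
      then show "norm (gap (\<sigma> \<omega>) \<omega>) \<le> B"
        using order_trans[OF gap_F[of \<omega> "\<sigma> \<omega>"] B] that(2) by (simp add: gap_def)
    qed
    show "(\<lambda>\<omega>. gap (\<sigma> \<omega>) \<omega>) \<in> borel_measurable M"
    proof (rule borel_measurable_at_random_time[OF _ _ that])
      fix \<omega> assume \<omega>: "\<omega> \<in> space M"
      have "continuous_on {0..} (\<lambda>t. q t \<omega>)"
        by (rule momentum_flow_position_continuous[OF assms(20)[OF \<omega>]])
      moreover have "continuous_on {0..} (\<lambda>t. \<theta> t \<omega>)"
        using assms(21)[OF \<omega>] by (simp add: solves_gradient_flow_def)
      ultimately show "continuous_on {0..} (\<lambda>t. gap t \<omega>)"
        unfolding gap_def by (intro continuous_intros)
    next
      fix t :: real assume "t \<ge> 0"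
      then have [measurable]: "q t \<in> borel_measurable M" "\<theta> t \<in> borel_measurable M"
        using assms(17,18) by auto
      show "gap t \<in> borel_measurable M"
        unfolding gap_def by measurable
    qed
  qed
  have \<tau>_nonneg: "\<tau> n \<omega> \<ge> 0" for n \<omega>
    by (simp add: \<tau>_def jump_time_nonneg)
  have \<tau>_measurable: "\<tau> n \<in> borel_measurable M" for n
    unfolding \<tau>_def
    by (rule jump_time_measurable) (use markov in \<open>auto simp: markov_process_def\<close>)
  have jumps_part: "(\<lambda>n. \<integral>\<omega>. gap (\<tau> n \<omega>) \<omega> \<partial>M) \<longlonglongrightarrow> 0" if "CARD('n) \<ge> 2"
  proof -
    have "AE \<omega> in M. jumps (\<lambda>t. i t \<omega>) \<inter> {real k<..} \<noteq> {}" for k :: nat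
      using matrix_exp_rate_matrix_diagonal_less_1[OF assms(3), of 1] that
      by (intro AE_jump_after[OF assms(14) markov]) auto
    then have "AE \<omega> in M. \<forall>k::nat. jumps (\<lambda>t. i t \<omega>) \<inter> {real k<..} \<noteq> {}"
      by (simp add: AE_all_countable)
    then have lim: "AE \<omega> in M. (\<lambda>n. gap (\<tau> n \<omega>) \<omega>) \<longlonglongrightarrow> 0"
    proof (rule AE_mp, intro AE_I2 impI)
      fix \<omega> assume \<omega>: "\<omega> \<in> space M" and inf: "\<forall>k::nat. jumps (\<lambda>t. i t \<omega>) \<inter> {real k<..} \<noteq> {}"
      have "jumps (\<lambda>t. i t \<omega>) \<inter> {T<..} \<noteq> {}" for T
      proof -
        obtain k :: nat where "T \<le> k" using real_arch_simple by blast
        then show ?thesis using inf[rule_format, of k] by fastforce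
      qed
      then have "filterlim (\<lambda>n. \<tau> n \<omega>) at_top sequentially"
        unfolding \<tau>_def by (rule jump_times_tendsto_infinity[OF path[OF \<omega>]])
      then have "(\<lambda>n. F (\<tau> n \<omega>)) \<longlonglongrightarrow> 0"
        by (rule filterlim_compose[OF F])
      then show "(\<lambda>n. gap (\<tau> n \<omega>) \<omega>) \<longlonglongrightarrow> 0"
        by (rule tendsto_sandwich[OF _ _ tendsto_const, rotated 2])
          (auto simp: gap_F[OF \<omega> \<tau>_nonneg], simp add: gap_def)
    qed
    have "(\<lambda>n. \<integral>\<omega>. gap (\<tau> n \<omega>) \<omega> \<partial>M) \<longlonglongrightarrow> (\<integral>\<omega>. 0 \<partial>M)"
    proof (rule integral_dominated_convergence[where w = "\<lambda>_. B"])
      show "(\<lambda>\<omega>. gap (\<tau> n \<omega>) \<omega>) \<in> borel_measurable M" for n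
        by (rule borel_measurable_integrable[OF gap_integrable[OF \<tau>_measurable \<tau>_nonneg]])
      show "AE \<omega> in M. norm (gap (\<tau> n \<omega>) \<omega>) \<le> B" for n
        using order_trans[OF gap_F[OF _ \<tau>_nonneg] B[OF \<tau>_nonneg]]
        by (intro AE_I2) (simp add: gap_def)
    qed (use lim in auto)
    then show ?thesis by simp
  qed
  have pathwise: "((\<lambda>t. gap t \<omega>) \<longlongrightarrow> 0) at_top" if "\<omega> \<in> space M" for \<omega>
  proof (rule tendsto_sandwich[OF _ _ tendsto_const F])
    show "\<forall>\<^sub>F t in at_top. gap t \<omega> \<le> F t"
      using eventually_ge_at_top[of 0] by eventually_elim (rule gap_F[OF that])
  qed (simp add: gap_def)
  have gap_t: "integrable M (gap t)" if "t \<ge> 0" for t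
    using gap_integrable[of "\<lambda>_. t"] that by simp
  have mean: "((\<lambda>t. \<integral>\<omega>. gap t \<omega> \<partial>M) \<longlongrightarrow> 0) at_top"
  proof (rule tendsto_sandwich[OF _ _ tendsto_const F])
    show "\<forall>\<^sub>F t in at_top. (\<integral>\<omega>. gap t \<omega> \<partial>M) \<le> F t"
      using eventually_ge_at_top[of 0]
      by eventually_elim (auto intro!: integral_le_const gap_t gap_F)
  qed (simp add: gap_def)
  show ?thesis
    using jumps_part gap_integrable[OF \<tau>_measurable \<tau>_nonneg] pathwise gap_t mean
    unfolding gap_def by auto
qed

end
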